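(* Let $\mathcal{H},\mathcal{Z}$ be Hilbert spaces, $\mathcal{B}$ a Banach space, $\flat:\mathcal{H}\times\mathcal{B}\to\mathcal{Z}$ a bounded bilinear mapping, and let $\xi:\mathcal{Z}\times\mathcal{B}\to\mathcal{H}$, $\xi(z,x)=\langle z/x\rangle$, be the $\flat$-dual product. Then: 1) $\xi$ is sesquilinear (linear in the first variable, anti-linear in the second). 2) $\xi$ is bounded and continuous. 3) Suppose that $\overline{\mathcal{R}(\flat)}=\mathcal{Z}$. If $z\in\mathcal{Z}$ satisfies $\langle z/x\rangle=0$ for every $x\in\mathcal{B}$, then $z=0$. 4) Suppose that there exists $m>0$ such that $m\|h\|_{\mathcal{H}}\|x\|\le\|\flat(h,x)\|_{\mathcal{Z}}$ for all $x\in\mathcal{B}$ and $h\in\mathcal{H}$. If $x\in\mathcal{B}$ satisfies $\langle z/x\rangle=0$ for every $z\in\mathcal{Z}$, then $x=0$.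
   Context: All spaces are over $\mathbb{C}$; inner products are linear in the first variable. Bounded bilinear means there is $M>0$ with $\|\flat(h,x)\|_{\mathcal{Z}}\le M\|h\|_{\mathcal{H}}\|x\|$ for all $h\in\mathcal{H}$, $x\in\mathcal{B}$. $\mathcal{R}(\flat)$ is the range of $\flat$. For $z\in\mathcal{Z}$, $x\in\mathcal{B}$, the $\flat$-dual product $\langle z/x\rangle\in\mathcal{H}$ is the unique vector (Riesz) with $\langle\flat(h,x),z\rangle_{\mathcal{Z}}=\langle h,\langle z/x\rangle\rangle_{\mathcal{H}}$ for all $h\in\mathcal{H}$. Bounded, for $\xi$, means $\|\xi(z,x)\|_{\mathcal{H}}\le C\|z\|_{\mathcal{Z}}\|x\|$ for some constant $C$ and all $(z,x)$; continuity is for the product topology on $\mathcal{Z}\times\mathcal{B}$.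
   Formalization: Part 4 is proved under the added assumption that the Hilbert space H is nonzero; for H = {0} and B ≠ {0} it fails as written, since the lower bound then holds trivially and every dual product ⟨z/x⟩ is 0. *)

theory Defs
  imports "HOL-Analysis.Analysis"
begin

class complex_normed_vector = real_normed_vector +
  fixes scaleC :: "complex \<Rightarrow> 'a \<Rightarrow> 'a"  (infixr \<open>*\<^sub>C\<close> 75)
  assumes scaleC_add_right: "a *\<^sub>C (x + y) = a *\<^sub>C x + a *\<^sub>C y"
    and scaleC_add_left: "(a + b) *\<^sub>C x = a *\<^sub>C x + b *\<^sub>C x"
    and scaleC_scaleC: "a *\<^sub>C b *\<^sub>C x = (a * b) *\<^sub>C x"
    and scaleC_of_real: "complex_of_real r *\<^sub>C x = r *\<^sub>R x"
    and norm_scaleC: "norm (a *\<^sub>C x) = cmod a * norm x"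

text \<open>The inner product is linear in the first variable.  Positive definiteness
  is contained in the last axiom, which makes the norm the one induced by the
  inner product.\<close>

class complex_inner = complex_normed_vector +
  fixes cinner :: "'a \<Rightarrow> 'a \<Rightarrow> complex"
  assumes cinner_commute: "cinner x y = cnj (cinner y x)"
    and cinner_add_left: "cinner (x + y) z = cinner x z + cinner y z"
    and cinner_scaleC_left: "cinner (a *\<^sub>C x) y = a * cinner x y"
    and cinner_self: "cinner x x = complex_of_real ((norm x)\<^sup>2)"

class complex_banach = complex_normed_vector + complete_space

class complex_hilbert = complex_inner + complete_space

definition clinear :: "('a::complex_normed_vector \<Rightarrow> 'b::complex_normed_vector) \<Rightarrow> bool"
  where "clinear f \<longleftrightarrow> Vector_Spaces.linear scaleC scaleC f"

definition antilinear :: "('a::complex_normed_vector \<Rightarrow> 'b::complex_normed_vector) \<Rightarrow> bool"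
  where "antilinear f \<longleftrightarrow>
    (\<forall>x y. f (x + y) = f x + f y) \<and> (\<forall>a x. f (a *\<^sub>C x) = cnj a *\<^sub>C f x)"

definition bounded_cbilinear ::
    "('a::complex_normed_vector \<Rightarrow> 'b::complex_normed_vector \<Rightarrow> 'c::complex_normed_vector) \<Rightarrow> bool"
  where "bounded_cbilinear f \<longleftrightarrow>
    (\<forall>y. clinear (\<lambda>x. f x y)) \<and> (\<forall>x. clinear (\<lambda>y. f x y)) \<and>
    (\<exists>M>0. \<forall>x y. norm (f x y) \<le> M * norm x * norm y)"

definition sesquilinear ::
    "('a::complex_normed_vector \<Rightarrow> 'b::complex_normed_vector \<Rightarrow> 'c::complex_normed_vector) \<Rightarrow> bool"
  where "sesquilinear f \<longleftrightarrow>
    (\<forall>y. clinear (\<lambda>x. f x y)) \<and> (\<forall>x. antilinear (\<lambda>y. f x y))"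

text \<open>For a bounded bilinear \<open>\<flat>\<close> on Hilbert spaces the description is proper by the
  Riesz representation theorem, applied to the functional \<open>h \<mapsto> \<langle>\<flat>(h, x), z\<rangle>\<close>.\<close>

definition dual_product ::
    "('h::complex_hilbert \<Rightarrow> 'b::complex_banach \<Rightarrow> 'z::complex_hilbert) \<Rightarrow> 'z \<Rightarrow> 'b \<Rightarrow> 'h"
  where "dual_product flat z x = (THE w. \<forall>h. cinner (flat h x) z = cinner h w)"

end

theory Submission
  imports Defs
begin

text \<open>The Riesz vector of a bounded functional \<open>f\<close> is found as the minimizer of
  \<open>J h = \<parallel>h\<parallel>\<^sup>2 - 2 Re (f h)\<close>: the parallelogram law makes minimizing sequences Cauchy, and the
  first variation of \<open>J\<close> at the minimizer is \<open>Re \<langle>h, w\<rangle> = Re (f h)\<close>.  With the dual product thus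
  characterized by its defining identity, every claim follows by testing it against suitable
  vectors.\<close>

section \<open>Complex linearity and the geometry of the inner product\<close>

lemma scaleC_one [simp]: "1 *\<^sub>C x = x"
  using scaleC_of_real[of 1 x] by simp

text \<open>\<open>Vector_Spaces.linear\<close> also bundles the vector space laws of both scalings;
  the class axioms discharge them, so only additivity and homogeneity remain.\<close>

lemma clinear_iff:
  "clinear f \<longleftrightarrow> (\<forall>x y. f (x + y) = f x + f y) \<and> (\<forall>a x. f (a *\<^sub>C x) = a *\<^sub>C f x)"
  unfolding clinear_def Vector_Spaces.linear_def module_hom_def vector_space_def module_def
    module_hom_axioms_def
  by (auto simp: scaleC_add_right scaleC_add_left scaleC_scaleC)

lemma cinner_add_right: "cinner x (y + z) = cinner x y + cinner x z"
  by (metis cinner_add_left cinner_commute complex_cnj_add)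

lemma cinner_scaleC_right: "cinner x (a *\<^sub>C y) = cnj a * cinner x y"
  by (metis cinner_scaleC_left cinner_commute complex_cnj_mult)

lemma cinner_scaleR_left: "cinner (r *\<^sub>R x) y = complex_of_real r * cinner x y"
  by (metis cinner_scaleC_left scaleC_of_real)

lemma cinner_scaleR_right: "cinner x (r *\<^sub>R y) = complex_of_real r * cinner x y"
  by (metis cinner_scaleC_right scaleC_of_real complex_cnj_complex_of_real)

lemma cinner_minus_right: "cinner x (- y) = - cinner x y"
  using cinner_scaleR_right[of x "- 1" y] by simp

lemma cinner_diff_right: "cinner x (y - z) = cinner x y - cinner x z"
  using cinner_add_right[of x y "- z"] by (simp add: cinner_minus_right)

lemma cinner_zero_right [simp]: "cinner x 0 = 0"
  using cinner_scaleR_right[of x 0 0] by simp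

lemma cinner_self_eq_zero_iff [simp]: "cinner x x = 0 \<longleftrightarrow> x = 0"
  by (simp add: cinner_self)

text \<open>Test with \<open>h = v - w\<close>. This gives uniqueness in the Riesz theorem and
  reduces identities between dual products to identities between scalars.\<close>

lemma cinner_ext_right:
  assumes "\<And>h. cinner h v = cinner h w"
  shows "v = w"
proof -
  have "cinner (v - w) (v - w) = 0"
    by (subst cinner_diff_right) (simp add: assms)
  then show ?thesis by simp
qed

lemma norm_add_squared:
  fixes x y :: "'a::complex_inner"
  shows "(norm (x + y))\<^sup>2 = (norm x)\<^sup>2 + 2 * Re (cinner x y) + (norm y)\<^sup>2"
proof -
  have "Re (cinner (x + y) (x + y)) = Re (cinner x x) + Re (cinner x y) + Re (cinner y x) + Re (cinner y y)"
    by (simp add: cinner_add_left cinner_add_right)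
  moreover have "Re (cinner y x) = Re (cinner x y)"
    by (subst cinner_commute) simp
  ultimately show ?thesis by (simp add: cinner_self)
qed

lemma parallelogram_law:
  fixes x y :: "'a::complex_inner"
  shows "(norm (x + y))\<^sup>2 + (norm (x - y))\<^sup>2 = 2 * (norm x)\<^sup>2 + 2 * (norm y)\<^sup>2"
  using norm_add_squared[of x y] norm_add_squared[of x "- y"] by (simp add: cinner_minus_right)

lemma cinner_Cauchy_Schwarz:
  fixes x y :: "'a::complex_inner"
  shows "cmod (cinner x y) \<le> norm x * norm y"
proof (cases "y = 0")
  case False
  define n where "n = (norm y)\<^sup>2"
  have n: "n > 0" using False by (simp add: n_def)
  \<comment> \<open>This choice makes \<open>x + c *\<^sub>C y\<close> the component of
    \<open>x\<close> orthogonal to \<open>y\<close>, so the expanded square norm is as small as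
    possible.\<close>
  define c where "c = - cinner x y / complex_of_real n"
  have "0 \<le> (norm (x + c *\<^sub>C y))\<^sup>2" by simp
  also have "\<dots> = (norm x)\<^sup>2 + 2 * Re (cnj c * cinner x y) + (cmod c)\<^sup>2 * n"
    unfolding norm_add_squared cinner_scaleC_right norm_scaleC n_def
    by (simp add: power_mult_distrib)
  also have "cnj c * cinner x y = - complex_of_real ((cmod (cinner x y))\<^sup>2 / n)"
    unfolding c_def using complex_norm_square[of "cinner x y"] by (simp add: mult.commute)
  also have "(cmod c)\<^sup>2 * n = (cmod (cinner x y))\<^sup>2 / n"
    unfolding c_def using n
    by (simp add: norm_divide power_divide power2_eq_square)
  finally have "(cmod (cinner x y))\<^sup>2 / n \<le> (norm x)\<^sup>2" by simp
  then have "(cmod (cinner x y))\<^sup>2 \<le> (norm x * norm y)\<^sup>2"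
    using n by (simp add: divide_le_eq n_def power_mult_distrib)
  then show ?thesis by (rule power2_le_imp_le) simp
qed simp

lemma continuous_on_cinner_left: "continuous_on S (\<lambda>x. cinner x y)"
proof -
  have "bounded_linear (\<lambda>x. cinner x y)"
    by (rule bounded_linear_intro[where K = "norm y"])
      (simp_all add: cinner_add_left cinner_scaleR_left scaleR_conv_of_real cinner_Cauchy_Schwarz)
  then show ?thesis by (rule linear_continuous_on)
qed

text \<open>The quadratic has its minimum at 0, so its derivative there vanishes.\<close>

lemma quadratic_nonneg_imp_zero:
  fixes a b :: real
  assumes "\<And>t. 0 \<le> a * t\<^sup>2 + b * t"
  shows "b = 0"
proof (rule ccontr)
  assume b: "b \<noteq> 0"
  have a: "0 \<le> a" using assms[of 1] assms[of "- 1"] by simp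
  \<comment> \<open>Dividing by \<open>a + 1\<close> avoids a zero denominator and makes
    \<open>a * t + b\<close> exactly \<open>- t\<close>, so the quadratic takes the value
    \<open>- (t\<^sup>2)\<close>.\<close>
  define t where "t = - b / (a + 1)"
  have "(a + 1) * t = - b" using a by (simp add: t_def)
  then have "a * t + b = - t" by (simp add: algebra_simps)
  moreover have "a * t\<^sup>2 + b * t = (a * t + b) * t"
    by (simp add: power2_eq_square algebra_simps)
  ultimately have "a * t\<^sup>2 + b * t = - (t\<^sup>2)"
    by (simp add: power2_eq_square)
  moreover have "t\<^sup>2 > 0" using a b by (simp add: t_def)
  ultimately show False using assms[of t] by linarith
qed

section \<open>The Riesz representation theorem\<close>

theorem Riesz_representation:
  fixes f :: "'a::complex_hilbert \<Rightarrow> complex"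
  assumes add: "\<And>x y. f (x + y) = f x + f y"
    and scale: "\<And>a x. f (a *\<^sub>C x) = a * f x"
    and bound: "\<And>x. cmod (f x) \<le> K * norm x"
  shows "\<exists>!w. \<forall>h. f h = cinner h w"
proof -
  have scaleR: "f (r *\<^sub>R x) = complex_of_real r * f x" for r x
    using scale[of "complex_of_real r" x] by (simp add: scaleC_of_real)
  define J where "J h = (norm h)\<^sup>2 - 2 * Re (f h)" for h
  \<comment> \<open>Complete the square in \<open>norm h\<close>.\<close>
  have J_bound: "- K\<^sup>2 \<le> J h" for h
  proof -
    have "Re (f h) \<le> K * norm h"
      using bound[of h] complex_Re_le_cmod[of "f h"] by linarith
    moreover have "0 \<le> (norm h - K)\<^sup>2" by simp
    ultimately show ?thesis unfolding J_def power2_diff by (simp add: mult.commute)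
  qed
  define d where "d = (INF h. J h)"
  have bdd: "bdd_below (range J)"
    using J_bound by (intro bdd_belowI[where m = "- K\<^sup>2"]) auto
  have d_le: "d \<le> J h" for h
    unfolding d_def by (rule cINF_lower[OF bdd]) simp
  have "\<exists>h. J h < d + 1 / real (Suc n)" for n
    using cINF_less_iff[OF _ bdd, of "d + 1 / real (Suc n)"] by (simp add: d_def)
  then obtain X where X: "J (X n) < d + 1 / real (Suc n)" for n by metis
  \<comment> \<open>Compare with the midpoint \<open>m\<close>: the linear parts of \<open>J\<close>
    cancel, the parallelogram law leaves half of the squared distance, and \<open>J m\<close> is at
    least \<open>d\<close>.\<close>
  have gap: "(norm (x - y))\<^sup>2 \<le> 2 * (J x - d) + 2 * (J y - d)" for x y
  proof -
    define m where "m = (1/2) *\<^sub>R (x + y)"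
    have "J x + J y - 2 * J m = (norm (x - y))\<^sup>2 / 2"
      using parallelogram_law[of x y] unfolding J_def m_def scaleR add norm_scaleR
      by (simp add: power_divide add_divide_distrib)
    then have "(norm (x - y))\<^sup>2 = 2 * J x + 2 * J y - 4 * J m" by simp
    with d_le[of m] show ?thesis by simp
  qed
  have "Cauchy X"
  proof (rule metric_CauchyI)
    fix e :: real assume e: "0 < e"
    \<comment> \<open>With this \<open>N\<close> each of the two terms in \<open>gap\<close> stays
      below half of \<open>e\<^sup>2\<close>.\<close>
    obtain N where N: "4 / e\<^sup>2 < real N" using reals_Archimedean2 by blast
    have small: "2 * (J (X n) - d) < e\<^sup>2 / 2" if "n \<ge> N" for n
    proof -
      have "4 / e\<^sup>2 < real (Suc n)" using N that by simp
      then have "1 / real (Suc n) < e\<^sup>2 / 4" using e by (simp add: field_simps)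
      then have "J (X n) < d + e\<^sup>2 / 4"
        by (intro less_trans[OF X add_strict_left_mono])
      then show ?thesis by simp
    qed
    have "dist (X m) (X n) < e" if "m \<ge> N" "n \<ge> N" for m n
    proof -
      have "(norm (X m - X n))\<^sup>2 < e\<^sup>2"
        using gap[of "X m" "X n"] small[OF that(1)] small[OF that(2)] by linarith
      then show ?thesis unfolding dist_norm by (rule power2_less_imp_less) (use e in simp)
    qed
    then show "\<exists>M. \<forall>m\<ge>M. \<forall>n\<ge>M. dist (X m) (X n) < e" by blast
  qed
  then obtain w where w: "X \<longlonglongrightarrow> w"
    by (auto simp: Cauchy_convergent_iff convergent_def)
  have f_lin: "bounded_linear f"
    by (rule bounded_linear_intro[where K = K])
      (simp_all add: add scaleR scaleR_conv_of_real bound mult.commute)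
  have "(\<lambda>n. J (X n)) \<longlonglongrightarrow> J w"
    unfolding J_def by (intro tendsto_intros w bounded_linear.tendsto[OF f_lin])
  moreover have "(\<lambda>n. d + 1 / real (Suc n)) \<longlonglongrightarrow> d"
    using tendsto_add[OF tendsto_const[of d] LIMSEQ_inverse_real_of_nat]
    by (simp add: inverse_eq_divide)
  ultimately have J_min: "J w \<le> d"
    by (rule LIMSEQ_le) (use X less_imp_le in blast)
  have Re_eq: "Re (f h) = Re (cinner h w)" for h
  proof -
    \<comment> \<open>The right-hand side is \<open>J (t *\<^sub>R h + w) - J w\<close> expanded in
      \<open>t\<close>.\<close>
    have "0 \<le> (norm h)\<^sup>2 * t\<^sup>2 + 2 * (Re (cinner h w) - Re (f h)) * t" for t
    proof -
      have "J w \<le> J (t *\<^sub>R h + w)" using J_min d_le order_trans by blast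
      then show ?thesis
        unfolding J_def norm_add_squared add scaleR cinner_scaleR_left
        by (simp add: power_mult_distrib algebra_simps)
    qed
    from quadratic_nonneg_imp_zero[OF this] show ?thesis by simp
  qed
  \<comment> \<open>Real parts suffice: at \<open>\<i> *\<^sub>C h\<close> they give the negated
    imaginary parts at \<open>h\<close>.\<close>
  have "f h = cinner h w" for h
    using Re_eq[of h] Re_eq[of "\<i> *\<^sub>C h"]
    by (simp add: scale cinner_scaleC_left complex_eq_iff)
  then show ?thesis by (metis cinner_ext_right)
qed

lemma bounded_cbilinearD:
  assumes "bounded_cbilinear f"
  shows "f (x + x') y = f x y + f x' y" "f (a *\<^sub>C x) y = a *\<^sub>C f x y"
    and "f x (y + y') = f x y + f x y'" "f x (a *\<^sub>C y) = a *\<^sub>C f x y"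
    and "\<exists>M>0. \<forall>x y. norm (f x y) \<le> M * norm x * norm y"
proof -
  have y: "clinear (\<lambda>x. f x y)" for y
    using assms unfolding bounded_cbilinear_def by (elim conjE) (erule spec)
  have x: "clinear (\<lambda>y. f x y)" for x
    using assms unfolding bounded_cbilinear_def by (elim conjE) (erule spec)
  show "f (x + x') y = f x y + f x' y" "f (a *\<^sub>C x) y = a *\<^sub>C f x y"
    using y[of y] by (simp_all add: clinear_iff)
  show "f x (y + y') = f x y + f x y'" "f x (a *\<^sub>C y) = a *\<^sub>C f x y"
    using x[of x] by (simp_all add: clinear_iff)
  show "\<exists>M>0. \<forall>x y. norm (f x y) \<le> M * norm x * norm y"
    using assms unfolding bounded_cbilinear_def by (elim conjE)
qed

text \<open>Riesz, applied with the bound \<open>M * norm x * norm z\<close>, makes the definite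
  description proper. From here on only this identity is used, never the description itself.\<close>

lemma cinner_dual_product:
  assumes flat: "bounded_cbilinear flat"
  shows "cinner h (dual_product flat z x) = cinner (flat h x) z"
proof -
  from bounded_cbilinearD(5)[OF flat] obtain M
    where M: "\<forall>h x. norm (flat h x) \<le> M * norm h * norm x" by (elim exE conjE)
  have bound: "cmod (cinner (flat k x) z) \<le> (M * norm x * norm z) * norm k" for k
  proof -
    have "cmod (cinner (flat k x) z) \<le> norm (flat k x) * norm z"
      by (rule cinner_Cauchy_Schwarz)
    also have "\<dots> \<le> (M * norm k * norm x) * norm z"
      by (rule mult_right_mono[OF M[rule_format] norm_ge_zero])
    finally show ?thesis by (simp only: mult_ac)
  qed
  have "\<exists>!w. \<forall>k. cinner (flat k x) z = cinner k w"
    by (rule Riesz_representation[OF _ _ bound])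
      (simp_all add: bounded_cbilinearD(1,2)[OF flat] cinner_add_left cinner_scaleC_left)
  from theI'[OF this] have "\<forall>k. cinner (flat k x) z = cinner k (dual_product flat z x)"
    unfolding dual_product_def .
  from this[rule_format, of h] show ?thesis by (rule sym)
qed

text \<open>In the defining identity \<open>z\<close> and the dual product both occupy the
  antilinear slot of an inner product, so the conjugates match; \<open>x\<close> enters through the
  linear slot, so its scalars come out conjugated.\<close>

lemma sesquilinear_dual_product:
  assumes flat: "bounded_cbilinear flat"
  shows "sesquilinear (dual_product flat)"
  unfolding sesquilinear_def clinear_iff antilinear_def
  by (intro conjI allI; rule cinner_ext_right)
    (simp_all add: cinner_dual_product[OF flat] bounded_cbilinearD(3,4)[OF flat]
      cinner_add_left cinner_add_right cinner_scaleC_left cinner_scaleC_right)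

text \<open>Testing the identity with the dual product itself bounds its squared norm by a multiple
  of its norm; cancelling one factor shows that the bound \<open>M\<close> of \<open>flat\<close>
  serves as \<open>C\<close>.\<close>

lemma norm_dual_product_le:
  assumes flat: "bounded_cbilinear flat"
  shows "\<exists>C. \<forall>z x. norm (dual_product flat z x) \<le> C * norm z * norm x"
proof -
  from bounded_cbilinearD(5)[OF flat] obtain M
    where "M > 0" and M: "\<forall>h x. norm (flat h x) \<le> M * norm h * norm x" by (elim exE conjE)
  have "norm (dual_product flat z x) \<le> M * norm z * norm x" for z x
  proof -
    let ?w = "dual_product flat z x"
    have "norm ?w * norm ?w = cmod (cinner ?w ?w)"
      by (simp only: cinner_self norm_of_real) (simp add: power2_eq_square)
    also have "\<dots> = cmod (cinner (flat ?w x) z)"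
      by (simp only: cinner_dual_product[OF flat])
    also have "\<dots> \<le> norm (flat ?w x) * norm z"
      by (rule cinner_Cauchy_Schwarz)
    also have "\<dots> \<le> (M * norm ?w * norm x) * norm z"
      by (rule mult_right_mono[OF M[rule_format] norm_ge_zero])
    also have "\<dots> = (M * norm z * norm x) * norm ?w" by (simp only: mult_ac)
    finally have le: "norm ?w * norm ?w \<le> (M * norm z * norm x) * norm ?w" .
    show ?thesis
    proof (cases "?w = 0")
      case True
      then show ?thesis using \<open>M > 0\<close> by simp
    next
      case False
      then show ?thesis using mult_right_le_imp_le[OF le] by simp
    qed
  qed
  then show ?thesis by blast
qed

text \<open>Conjugation fixes real scalars, so over the reals the map is bilinear, and joint
  continuity follows from the theory of \<open>bounded_bilinear\<close>.\<close>

lemma sesquilinear_imp_bounded_bilinear: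
  assumes "sesquilinear f" and "\<And>x y. norm (f x y) \<le> C * norm x * norm y"
  shows "bounded_bilinear f"
proof
  note s = assms(1)[unfolded sesquilinear_def clinear_iff antilinear_def]
  show "f (x + x') y = f x y + f x' y" "f x (y + y') = f x y + f x y'" for x x' y y'
    using s by blast+
  show "f (r *\<^sub>R x) y = r *\<^sub>R f x y" "f x (r *\<^sub>R y) = r *\<^sub>R f x y" for r x y
    using s by (simp_all flip: scaleC_of_real)
  show "\<exists>K. \<forall>x y. norm (f x y) \<le> norm x * norm y * K"
    using assms(2) by (metis mult.assoc mult.commute)
qed

theorem proposition1p1:
  fixes flat :: "'h::complex_hilbert \<Rightarrow> 'b::complex_banach \<Rightarrow> 'z::complex_hilbert"
    and \<xi> :: "'z \<Rightarrow> 'b \<Rightarrow> 'h"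
  assumes "bounded_cbilinear flat"
    and "\<xi> = dual_product flat"
  shows "sesquilinear \<xi> \<and>
    (\<exists>C. \<forall>z x. norm (\<xi> z x) \<le> C * norm z * norm x) \<and>
    continuous_on UNIV (\<lambda>(z, x). \<xi> z x) \<and>
    (closure (range (\<lambda>(h, x). flat h x)) = UNIV \<longrightarrow>
      (\<forall>z. (\<forall>x. \<xi> z x = 0) \<longrightarrow> z = 0)) \<and>
    ((\<exists>h::'h. h \<noteq> 0) \<longrightarrow>
      (\<exists>m>0. \<forall>h x. m * norm h * norm x \<le> norm (flat h x)) \<longrightarrow>
      (\<forall>x. (\<forall>z. \<xi> z x = 0) \<longrightarrow> x = 0))"
proof (intro conjI impI allI)
  show sesq: "sesquilinear \<xi>"
    using sesquilinear_dual_product[OF assms(1)] by (simp add: assms(2))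
  show bounded: "\<exists>C. \<forall>z x. norm (\<xi> z x) \<le> C * norm z * norm x"
    using norm_dual_product_le[OF assms(1)] by (simp add: assms(2))
  have "bounded_bilinear \<xi>"
    using bounded sesquilinear_imp_bounded_bilinear[OF sesq] by blast
  then show "continuous_on UNIV (\<lambda>(z, x). \<xi> z x)"
    unfolding case_prod_unfold
    by (rule bounded_bilinear.continuous_on[OF _ continuous_on_fst continuous_on_snd])
      (rule continuous_on_id)+
next
  note dual = cinner_dual_product[OF assms(1), folded assms(2)]
  fix z
  assume dense: "closure (range (\<lambda>(h, x). flat h x)) = UNIV" and 0: "\<forall>x. \<xi> z x = 0"
  \<comment> \<open>The orthogonal complement of \<open>z\<close> is closed and contains the range
    of \<open>flat\<close>, hence by density everything, including \<open>z\<close>.\<close>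
  have "closed {y. cinner y z = 0}"
    by (intro closed_Collect_eq continuous_on_cinner_left continuous_on_const)
  moreover have "range (\<lambda>(h, x). flat h x) \<subseteq> {y. cinner y z = 0}"
    using 0 by (auto simp flip: dual)
  ultimately have "UNIV \<subseteq> {y. cinner y z = 0}"
    using closure_minimal dense by metis
  then have "cinner z z = 0" by blast
  then show "z = 0" by simp
next
  note dual = cinner_dual_product[OF assms(1), folded assms(2)]
  fix x
  assume "\<exists>h::'h. h \<noteq> 0" and "\<exists>m>0. \<forall>h x. m * norm h * norm x \<le> norm (flat h x)"
    and 0: "\<forall>z. \<xi> z x = 0"
  \<comment> \<open>A nonzero \<open>h\<close> is essential: on the zero space the lower bound is
    vacuous and says nothing about \<open>x\<close>.\<close>
  then obtain h :: 'h and m where h: "h \<noteq> 0" and m: "m > 0" "m * norm h * norm x \<le> norm (flat h x)"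
    by blast
  \<comment> \<open>Take \<open>z = flat h x\<close> in the hypothesis.\<close>
  have "cinner (flat h x) (flat h x) = 0"
    using 0 by (simp flip: dual)
  then have "m * norm h * norm x \<le> 0" using m(2) by simp
  then show "x = 0" using h m(1) by (simp add: mult_le_0_iff)
qed

end
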